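(* Let $\mu$ be a compactly supported probability measure on $\mathbb{R}^n$ whose support is not included in a hyperplane. Denote by $K$ the convex hull of the support of $\mu$ and by $D$ the ($\ell^2$-)diameter of $K$. Let $f:\mathbb{R}^n\to\mathbb{R}$ be a continuously differentiable function. Let $\delta>0$ and let $\mathcal{D}_\delta$ be a $\delta/D$-net, for the $\ell^2$-norm, of the convex hull of $\nabla f(K)$. Then $$\log\int e^{f}\,d\mu\;\le\;\sup_{y\in\mathbb{R}^n}\{f(y)-\Lambda_\mu^*(y)\}+\log|\mathcal{D}_\delta|+\delta .$$
   Context: The logarithmic Laplace transform of $\mu$ is $\Lambda_\mu(\lambda)=\log\int e^{\langle\lambda,x\rangle}d\mu(x)$, $\lambda\in\mathbb{R}^n$, and its Legendre transform is $\Lambda^*_\mu(x)=\sup_{\lambda\in\mathbb{R}^n}\{\langle\lambda,x\rangle-\Lambda_\mu(\lambda)\}\in[0,+\infty]$. An $\varepsilon$-net of a set $A$ for a norm is a finite set of points such that every point of $A$ is at distance at most $\varepsilon$ from some point of the set; $|\cdot|$ denotes cardinality. *)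

theory Defs
  imports "HOL-Probability.Probability"
begin

definition measure_support :: "'a::topological_space measure \<Rightarrow> 'a set" where
  "measure_support M = {x. \<forall>U. open U \<and> x \<in> U \<longrightarrow> emeasure M U > 0}"

(* Hyperplanes are affine. *)
definition is_hyperplane :: "'a::real_inner set \<Rightarrow> bool" where
  "is_hyperplane H \<longleftrightarrow> (\<exists>a b. a \<noteq> 0 \<and> H = {x. a \<bullet> x = b})"

(* Real-valued, hence meaningful only when the exponential moments of M are finite,
   as they are for a compactly supported probability measure. *)
definition log_laplace :: "'a::euclidean_space measure \<Rightarrow> 'a \<Rightarrow> real" where
  "log_laplace M l = ln (\<integral>x. exp (l \<bullet> x) \<partial>M)"

definition legendre_transform :: "('a::real_inner \<Rightarrow> real) \<Rightarrow> 'a \<Rightarrow> ereal" where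
  "legendre_transform L x = (SUP l. ereal (l \<bullet> x - L l))"

(* The points of the net are not required to lie in A. *)
definition is_eps_net :: "real \<Rightarrow> 'a::real_normed_vector set \<Rightarrow> 'a set \<Rightarrow> bool" where
  "is_eps_net \<epsilon> A N \<longleftrightarrow> finite N \<and> (\<forall>x\<in>A. \<exists>y\<in>N. norm (x - y) \<le> \<epsilon>)"

end

theory Submission
  imports Defs
begin

text \<open>
  Fix a point \<open>x\<close> of \<open>K\<close>. For \<open>y\<close> in \<open>K\<close>, the mean \<open>g y\<close> of the gradient of \<open>f\<close> over the segment
  from \<open>y\<close> to \<open>x\<close> lies in the convex hull of \<open>\<nabla>f(K)\<close> and satisfies \<open>f x - f y = g y \<bullet> (x - y)\<close>.
  By Brouwer's theorem the map \<open>y \<mapsto> \<nabla>\<Lambda>(g y)\<close>, which sends \<open>K\<close> to itself because \<open>\<nabla>\<Lambda>(l)\<close> is the mean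
  of the measure tilted by \<open>exp (l \<bullet> x)\<close>, has a fixed point \<open>y\<close>. There
  \<open>\<Lambda>\<^sup>*(y) = g y \<bullet> y - \<Lambda>(g y)\<close>, so \<open>f x = (f y - \<Lambda>\<^sup>*(y)) + g y \<bullet> x - \<Lambda>(g y)\<close>. Replacing \<open>g y\<close> by a
  nearby point \<open>v\<close> of the net changes \<open>g y \<bullet> x - \<Lambda>(g y)\<close> by at most \<open>\<delta>\<close>. Hence \<open>exp (f x)\<close> is at most
  \<open>exp (S + \<delta>)\<close> times the sum over the net of the densities \<open>exp (v \<bullet> x - \<Lambda>(v))\<close>, each of which
  integrates to 1.
\<close>

section \<open>Supports, means in closed convex sets, and integrals depending on a parameter\<close>

lemma AE_measure_support:
  fixes M :: "'a::second_countable_topology measure"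
  assumes "sets M = sets borel"
  shows "AE x in M. x \<in> measure_support M"
proof -
  let ?F = "{U. open U \<and> emeasure M U = 0}"
  \<comment> \<open>There may be uncountably many null open sets; Lindelof's theorem extracts a
    countable subfamily with the same union, which is therefore null.\<close>
  obtain F where F: "F \<subseteq> ?F" "countable F" "\<Union>F = \<Union>?F"
    by (rule Lindelof[of ?F]) blast+
  have "U \<in> null_sets M" if "U \<in> F" for U
    using F(1) assms that by (intro null_setsI) auto
  then have "(\<Union>U\<in>F. U) \<in> null_sets M"
    by (rule null_sets_UN'[OF F(2)])
  moreover have "{x \<in> space M. x \<notin> measure_support M} \<subseteq> (\<Union>U\<in>F. U)"
  proof
    fix x assume "x \<in> {x \<in> space M. x \<notin> measure_support M}"
    then obtain U where "open U" "x \<in> U" "emeasure M U = 0"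
      by (auto simp: measure_support_def not_gr_zero)
    then have "x \<in> \<Union>F"
      unfolding F(3) by blast
    then show "x \<in> (\<Union>U\<in>F. U)"
      by simp
  qed
  ultimately show ?thesis
    by (rule AE_I')
qed

text \<open>A mean outside \<open>C\<close> would be strictly separated from \<open>C\<close> by a
  hyperplane; integrating the separating inequality against \<open>w\<close> contradicts this. The
  weight lets tilted measures be treated as densities over \<open>M\<close>.\<close>

lemma weighted_mean_in_closed_convex:
  fixes h :: "'x \<Rightarrow> 'a::euclidean_space" and w :: "'x \<Rightarrow> real"
  assumes w: "integrable M w" "\<And>x. 0 \<le> w x" "(\<integral>x. w x \<partial>M) = 1"
    and wh: "integrable M (\<lambda>x. w x *\<^sub>R h x)"
    and C: "closed C" "convex C" "AE x in M. h x \<in> C"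
  shows "(\<integral>x. w x *\<^sub>R h x \<partial>M) \<in> C"
proof (rule ccontr)
  assume "(\<integral>x. w x *\<^sub>R h x \<partial>M) \<notin> C"
  then obtain a b where ab: "a \<bullet> (\<integral>x. w x *\<^sub>R h x \<partial>M) < b" "\<forall>x\<in>C. a \<bullet> x > b"
    using separating_hyperplane_closed_point[OF C(2,1)] by blast
  have "b = (\<integral>x. w x * b \<partial>M)"
    using w by simp
  also have "\<dots> \<le> (\<integral>x. a \<bullet> (w x *\<^sub>R h x) \<partial>M)"
  proof (rule integral_mono_AE)
    show "AE x in M. w x * b \<le> a \<bullet> (w x *\<^sub>R h x)"
      using C(3) by eventually_elim (use ab(2) w(2) in \<open>auto intro!: mult_left_mono intro: less_imp_le\<close>)
  qed (use w wh in \<open>simp_all del: inner_scaleR_right\<close>)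
  also have "\<dots> = a \<bullet> (\<integral>x. w x *\<^sub>R h x \<partial>M)"
    using wh by (simp del: inner_scaleR_right)
  finally show False
    using ab(1) by simp
qed

text \<open>The same separation argument, for the gauge integral in which the fundamental theorem of
  calculus is phrased.\<close>

lemma integral_unit_interval_in_closed_convex:
  fixes h :: "real \<Rightarrow> 'a::euclidean_space"
  assumes h: "h integrable_on {0..1}"
    and C: "closed C" "convex C" "\<And>t. t \<in> {0..1} \<Longrightarrow> h t \<in> C"
  shows "integral {0..1} h \<in> C"
proof (rule ccontr)
  assume "integral {0..1} h \<notin> C"
  then obtain a b where ab: "a \<bullet> integral {0..1} h < b" "\<forall>x\<in>C. a \<bullet> x > b"
    using separating_hyperplane_closed_point[OF C(2,1)] by blast
  have "((\<lambda>t. a \<bullet> h t) has_integral a \<bullet> integral {0..1} h) {0..1}"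
    using has_integral_linear[OF integrable_integral[OF h] bounded_linear_inner_right[of a]]
    by (simp add: o_def)
  moreover have "((\<lambda>t. b) has_integral b) {0..1::real}"
    using has_integral_const_real[of b 0 1] by simp
  ultimately have "b \<le> a \<bullet> integral {0..1} h"
    using ab(2) C(3) by (elim has_integral_le[rotated]) (auto intro: less_imp_le)
  with ab(1) show False
    by simp
qed

lemma (in finite_measure) continuous_on_integral_param:
  fixes h :: "'p::{first_countable_topology,t2_space} \<Rightarrow> 'a \<Rightarrow> 'b::{banach,second_countable_topology}"
  assumes meas: "\<And>p. p \<in> S \<Longrightarrow> h p \<in> borel_measurable M"
    and cont: "AE x in M. continuous_on S (\<lambda>p. h p x)"
    and bound: "AE x in M. \<forall>p\<in>S. norm (h p x) \<le> B"
  shows "continuous_on S (\<lambda>p. \<integral>x. h p x \<partial>M)"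
  unfolding continuous_on_sequentially
proof (intro allI ballI impI)
  fix s and a assume "a \<in> S" and s: "(\<forall>n. s n \<in> S) \<and> s \<longlonglongrightarrow> a"
  show "((\<lambda>p. \<integral>x. h p x \<partial>M) \<circ> s) \<longlonglongrightarrow> (\<integral>x. h a x \<partial>M)"
    unfolding o_def
  proof (rule integral_dominated_convergence)
    show "AE x in M. (\<lambda>n. h (s n) x) \<longlonglongrightarrow> h a x"
      using cont by eventually_elim (use s \<open>a \<in> S\<close> in \<open>auto simp: continuous_on_sequentially o_def\<close>)
    show "AE x in M. norm (h (s n) x) \<le> B" for n
      using bound by eventually_elim (use s in auto)
  qed (use meas s \<open>a \<in> S\<close> in auto)
qed

section \<open>The mean of a vector field along a segment\<close>

definition segment_gradient :: "('a::euclidean_space \<Rightarrow> 'a) \<Rightarrow> 'a \<Rightarrow> 'a \<Rightarrow> 'a" where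
  "segment_gradient F x y = integral {0..1} (\<lambda>t. F (y + t *\<^sub>R (x - y)))"

text \<open>Brouwer's theorem requires this continuity. It is the reason for averaging over the
  segment: an intermediate point from the mean value theorem need not vary continuously with
  \<open>y\<close>.\<close>

lemma continuous_on_segment_gradient:
  assumes "continuous_on UNIV F"
  shows "continuous_on S (segment_gradient F x)"
  unfolding segment_gradient_def box_real(2)[symmetric]
proof (rule integral_continuous_on_param)
  show "continuous_on (S \<times> cbox 0 1) (\<lambda>(y, t). F (y + t *\<^sub>R (x - y)))"
    unfolding split_beta by (rule continuous_on_compose2[OF assms]) (intro continuous_intros subset_UNIV)+
qed

lemma segment_gradient_integrable:
  fixes F :: "'a::euclidean_space \<Rightarrow> 'a"
  assumes "continuous_on UNIV F"
  shows "(\<lambda>t. F (y + t *\<^sub>R (x - y))) integrable_on {0..1}"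
  by (rule integrable_continuous_interval, rule continuous_on_compose2[OF assms])
     (intro continuous_intros subset_UNIV)+

lemma segment_gradient_mem:
  assumes F: "continuous_on UNIV F" and K: "compact K" "convex K" "x \<in> K" "y \<in> K"
  shows "segment_gradient F x y \<in> convex hull (F ` K)"
  unfolding segment_gradient_def
proof (rule integral_unit_interval_in_closed_convex[OF segment_gradient_integrable[OF F]])
  show "closed (convex hull (F ` K))"
    by (intro compact_imp_closed compact_convex_hull compact_continuous_image K(1)
        continuous_on_subset[OF F] subset_UNIV)
  fix t :: real assume t: "t \<in> {0..1}"
  have "y + t *\<^sub>R (x - y) = (1 - t) *\<^sub>R y + t *\<^sub>R x"
    by (simp add: algebra_simps)
  also have "\<dots> \<in> K"
    using K t by (simp add: convex_alt)
  finally show "F (y + t *\<^sub>R (x - y)) \<in> convex hull (F ` K)"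
    by (simp add: hull_inc)
qed (rule convex_convex_hull)

text \<open>The fundamental theorem of calculus for \<open>f\<close> along the segment from
  \<open>y\<close> to \<open>x\<close>.\<close>

lemma segment_gradient_mean_value:
  assumes f: "\<And>x. GDERIV f x :> F x" and F: "continuous_on UNIV F"
  shows "f x - f y = segment_gradient F x y \<bullet> (x - y)"
proof -
  let ?p = "\<lambda>t::real. y + t *\<^sub>R (x - y)"
  have "((\<lambda>t. F (?p t) \<bullet> (x - y)) has_integral f (?p 1) - f (?p 0)) {0..1}"
  proof (rule fundamental_theorem_of_calculus)
    fix t :: real
    have "(?p has_derivative (\<lambda>s. s *\<^sub>R (x - y))) (at t within {0..1})"
      by (rule derivative_eq_intros refl)+ simp
    then have "((\<lambda>t. f (?p t)) has_derivative (\<lambda>s. (s *\<^sub>R (x - y)) \<bullet> F (?p t))) (at t within {0..1})"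
      by (rule has_derivative_compose[OF _ f[unfolded gderiv_def]])
    then show "((\<lambda>t. f (?p t)) has_vector_derivative F (?p t) \<bullet> (x - y)) (at t within {0..1})"
      by (simp add: has_vector_derivative_def inner_commute)
  qed simp
  moreover have "((\<lambda>t. F (?p t) \<bullet> (x - y)) has_integral segment_gradient F x y \<bullet> (x - y)) {0..1}"
    using has_integral_linear[OF integrable_integral[OF segment_gradient_integrable[OF F]]
        bounded_linear_inner_left[of "x - y"]]
    by (simp add: segment_gradient_def o_def)
  ultimately have "f (?p 1) - f (?p 0) = segment_gradient F x y \<bullet> (x - y)"
    by (rule has_integral_unique)
  then show ?thesis
    by simp
qed

section \<open>The logarithmic Laplace transform of a probability measure carried by a compact
  set\<close>

locale compactly_carried_prob = prob_space M for M :: "'a::euclidean_space measure" +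
  fixes K :: "'a set"
  assumes sets_M: "sets M = sets borel"
    and compact_K: "compact K"
    and AE_K: "AE x in M. x \<in> K"
begin

lemma K_nonempty: "K \<noteq> {}"
  using AE_K AE_False by auto

lemma continuous_measurable [measurable]:
  fixes h :: "'a \<Rightarrow> 'b::topological_space"
  assumes "continuous_on UNIV h"
  shows "h \<in> borel_measurable M"
  using borel_measurable_continuous_onI[OF assms] sets_M by (simp cong: measurable_cong_sets)

lemma continuous_integrable:
  fixes h :: "'a \<Rightarrow> 'b::{banach,second_countable_topology}"
  assumes "continuous_on UNIV h"
  shows "integrable M h"
proof -
  have "bounded (h ` K)"
    by (intro compact_imp_bounded compact_continuous_image compact_K
        continuous_on_subset[OF assms] subset_UNIV)
  then obtain B where B: "\<And>x. x \<in> K \<Longrightarrow> norm (h x) \<le> B"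
    by (auto simp: bounded_iff)
  show ?thesis
    by (intro integrable_const_bound[OF eventually_mono[OF AE_K B]] continuous_measurable assms)
qed

lemma integral_exp_pos:
  fixes h :: "'a \<Rightarrow> real"
  assumes "continuous_on UNIV h"
  shows "0 < (\<integral>x. exp (h x) \<partial>M)"
proof -
  obtain z where z: "\<And>x. x \<in> K \<Longrightarrow> h z \<le> h x"
    using continuous_attains_inf[OF compact_K K_nonempty] assms continuous_on_subset by blast
  have "exp (h z) \<le> (\<integral>x. exp (h x) \<partial>M)"
    by (intro integral_ge_const continuous_integrable continuous_on_exp assms eventually_mono[OF AE_K])
      (use z in simp)
  then show ?thesis
    by (simp add: less_le_trans[OF exp_gt_zero])
qed

abbreviation partition_fun :: "'a \<Rightarrow> real" where
  "partition_fun l \<equiv> \<integral>x. exp (l \<bullet> x) \<partial>M"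

text \<open>The gradient of \<open>log_laplace M\<close> at \<open>l\<close>, given by its explicit
  formula so that nothing has to be differentiated under the integral.\<close>

definition tilted_mean :: "'a \<Rightarrow> 'a" where
  "tilted_mean l = (\<integral>x. exp (l \<bullet> x) *\<^sub>R x \<partial>M) /\<^sub>R partition_fun l"

lemma partition_fun_pos: "0 < partition_fun l"
  by (intro integral_exp_pos continuous_intros)

lemma partition_fun_nonzero [simp]: "partition_fun l \<noteq> 0"
  using partition_fun_pos[of l] by simp

lemma integrable_exp: "integrable M (\<lambda>x. exp (l \<bullet> x))"
  by (intro continuous_integrable continuous_intros)

lemma integrable_exp_scaleR: "integrable M (\<lambda>x. exp (l \<bullet> x) *\<^sub>R x)"
  by (intro continuous_integrable continuous_intros)

lemma exp_log_laplace: "exp (log_laplace M l) = partition_fun l"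
  by (simp add: log_laplace_def partition_fun_pos)

lemma tilted_mean_mem:
  assumes "convex K"
  shows "tilted_mean l \<in> K"
proof -
  have "(\<integral>x. (exp (l \<bullet> x) / partition_fun l) *\<^sub>R x \<partial>M) \<in> K"
  proof (rule weighted_mean_in_closed_convex)
    show "(\<integral>x. exp (l \<bullet> x) / partition_fun l \<partial>M) = 1"
      using partition_fun_pos[of l] by simp
    show "integrable M (\<lambda>x. (exp (l \<bullet> x) / partition_fun l) *\<^sub>R x)"
      using partition_fun_pos[of l] by (intro continuous_integrable continuous_intros) simp
    show "0 \<le> exp (l \<bullet> x) / partition_fun l" for x
      using partition_fun_pos[of l] by simp
  qed (use assms AE_K compact_K in \<open>auto intro: integrable_exp compact_imp_closed\<close>)
  also have "(\<integral>x. (exp (l \<bullet> x) / partition_fun l) *\<^sub>R x \<partial>M)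
      = (\<integral>x. inverse (partition_fun l) *\<^sub>R (exp (l \<bullet> x) *\<^sub>R x) \<partial>M)"
    by (simp only: scaleR_scaleR divide_inverse mult.commute)
  also have "\<dots> = tilted_mean l"
    unfolding tilted_mean_def by (rule integral_scaleR_right)
  finally show ?thesis .
qed

text \<open>Compactness of \<open>S \<times> K\<close> provides a constant that dominates the
  integrand almost everywhere, uniformly in the parameter.\<close>

lemma continuous_on_integral_compact:
  fixes h :: "'p::{first_countable_topology,t2_space} \<times> 'a \<Rightarrow> 'b::{banach,second_countable_topology}"
  assumes h: "continuous_on UNIV h" and S: "compact S"
  shows "continuous_on S (\<lambda>p. \<integral>x. h (p, x) \<partial>M)"
proof -
  have "bounded (h ` (S \<times> K))"
    by (intro compact_imp_bounded compact_continuous_image compact_Times S compact_K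
        continuous_on_subset[OF h] subset_UNIV)
  then obtain B where B: "\<And>p x. p \<in> S \<Longrightarrow> x \<in> K \<Longrightarrow> norm (h (p, x)) \<le> B"
    by (fastforce simp: bounded_iff)
  show ?thesis
  proof (rule continuous_on_integral_param)
    show "AE x in M. \<forall>p\<in>S. norm (h (p, x)) \<le> B"
      using AE_K by eventually_elim (use B in auto)
  qed (auto intro!: continuous_measurable AE_I2 continuous_intros continuous_on_compose2[OF h])
qed

lemma continuous_on_tilted_mean:
  assumes "compact S"
  shows "continuous_on S tilted_mean"
proof -
  have "continuous_on S partition_fun"
    using continuous_on_integral_compact[of "\<lambda>p. exp (fst p \<bullet> snd p)", OF _ assms]
    by (simp add: continuous_on_exp continuous_on_inner continuous_on_fst continuous_on_snd)
  moreover have "continuous_on S (\<lambda>l. \<integral>x. exp (l \<bullet> x) *\<^sub>R x \<partial>M)"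
    using continuous_on_integral_compact[of "\<lambda>p. exp (fst p \<bullet> snd p) *\<^sub>R snd p", OF _ assms]
    by (simp add: continuous_on_scaleR continuous_on_exp continuous_on_inner continuous_on_fst
        continuous_on_snd)
  ultimately show ?thesis
    unfolding tilted_mean_def
    by (intro continuous_intros) auto
qed

text \<open>Jensen's inequality for the measure tilted by \<open>u\<close>: integrate
  \<open>1 + t \<le> exp t\<close> at \<open>t = (v - u) \<bullet> (x - ?m)\<close>, a quantity
  whose tilted mean is zero.\<close>

lemma log_laplace_tangent:
  "log_laplace M u + (v - u) \<bullet> tilted_mean u \<le> log_laplace M v"
proof -
  let ?m = "tilted_mean u" and ?Z = "partition_fun u"
  have mean: "(\<integral>x. exp (u \<bullet> x) *\<^sub>R x \<partial>M) = ?Z *\<^sub>R ?m"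
    using partition_fun_pos[of u] by (simp add: tilted_mean_def)
  have "exp ((v - u) \<bullet> ?m) * ?Z
      = exp ((v - u) \<bullet> ?m) *
        (?Z * (1 - (v - u) \<bullet> ?m) + (v - u) \<bullet> (\<integral>x. exp (u \<bullet> x) *\<^sub>R x \<partial>M))"
    unfolding mean by (simp add: algebra_simps)
  also have "\<dots> = (\<integral>x. exp ((v - u) \<bullet> ?m) *
      (exp (u \<bullet> x) * (1 - (v - u) \<bullet> ?m) + (v - u) \<bullet> (exp (u \<bullet> x) *\<^sub>R x)) \<partial>M)"
    using integrable_exp[of u] integrable_exp_scaleR[of u]
    by (simp del: inner_scaleR_right)
  also have "\<dots> \<le> partition_fun v"
  proof (rule integral_mono)
    fix x
    have "exp ((v - u) \<bullet> ?m) *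
        (exp (u \<bullet> x) * (1 - (v - u) \<bullet> ?m) + (v - u) \<bullet> (exp (u \<bullet> x) *\<^sub>R x))
      = exp ((v - u) \<bullet> ?m + u \<bullet> x) * (1 + (v - u) \<bullet> (x - ?m))"
      by (simp add: exp_add inner_diff_right ring_distribs mult_ac)
    also have "\<dots> \<le> exp ((v - u) \<bullet> ?m + u \<bullet> x) * exp ((v - u) \<bullet> (x - ?m))"
      by (intro mult_left_mono exp_ge_add_one_self) simp
    also have "\<dots> = exp (v \<bullet> x)"
      by (simp add: algebra_simps flip: exp_add)
    finally show "exp ((v - u) \<bullet> ?m) *
        (exp (u \<bullet> x) * (1 - (v - u) \<bullet> ?m) + (v - u) \<bullet> (exp (u \<bullet> x) *\<^sub>R x)) \<le> exp (v \<bullet> x)" .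
  qed (intro continuous_integrable continuous_intros)+
  finally have "exp (log_laplace M u + (v - u) \<bullet> ?m) \<le> exp (log_laplace M v)"
    by (simp add: exp_add exp_log_laplace mult.commute)
  then show ?thesis
    by simp
qed

text \<open>By the tangent inequality, the supremum is attained at \<open>l = u\<close>.\<close>

lemma legendre_transform_tilted_mean:
  "legendre_transform (log_laplace M) (tilted_mean u)
    = ereal (u \<bullet> tilted_mean u - log_laplace M u)"
  unfolding legendre_transform_def
proof (rule antisym[OF SUP_least SUP_upper2[of u]])
  fix l
  show "ereal (l \<bullet> tilted_mean u - log_laplace M l) \<le> ereal (u \<bullet> tilted_mean u - log_laplace M u)"
    using log_laplace_tangent[of u l] by (simp add: inner_diff_left)
qed auto

text \<open>For \<open>z\<close> in \<open>K\<close>, \<open>(v - u) \<bullet> (z - x)\<close> is at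
  most \<open>\<delta>\<close> by Cauchy-Schwarz; exponentiating and integrating over
  \<open>z\<close> compares the two transforms. Only differences of points of \<open>K\<close>
  enter, hence the diameter.\<close>

lemma log_laplace_perturb:
  assumes "norm (u - v) * diameter K \<le> \<delta>" "x \<in> K"
  shows "u \<bullet> x - log_laplace M u \<le> v \<bullet> x - log_laplace M v + \<delta>"
proof -
  let ?c = "(v - u) \<bullet> x + \<delta>"
  have "partition_fun v \<le> (\<integral>z. exp ?c * exp (u \<bullet> z) \<partial>M)"
  proof (rule integral_mono_AE)
    show "AE z in M. exp (v \<bullet> z) \<le> exp ?c * exp (u \<bullet> z)"
      using AE_K
    proof eventually_elim
      fix z assume "z \<in> K"
      have "(v - u) \<bullet> (z - x) \<le> norm (v - u) * norm (z - x)"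
        by (rule norm_cauchy_schwarz)
      also have "\<dots> \<le> norm (v - u) * diameter K"
        using diameter_bounded_bound[OF compact_imp_bounded[OF compact_K] \<open>z \<in> K\<close> \<open>x \<in> K\<close>]
        by (intro mult_left_mono) (auto simp: dist_norm)
      also have "\<dots> \<le> \<delta>"
        using assms(1) by (simp add: norm_minus_commute)
      finally show "exp (v \<bullet> z) \<le> exp ?c * exp (u \<bullet> z)"
        by (simp add: algebra_simps flip: exp_add)
    qed
  qed (auto intro: integrable_exp)
  also have "\<dots> = exp (?c + log_laplace M u)"
    by (simp add: exp_add exp_log_laplace)
  finally have "exp (log_laplace M v) \<le> exp (?c + log_laplace M u)"
    by (simp add: exp_log_laplace)
  then show ?thesis
    by (simp add: inner_diff_left)
qed

text \<open>With \<open>y\<close> the Brouwer fixed point and \<open>u\<close> the mean gradient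
  from \<open>y\<close> to \<open>x\<close>, the Legendre transform at \<open>y\<close> is the real
  number \<open>u \<bullet> y - log_laplace M u\<close>. The two occurrences of
  \<open>log_laplace M u\<close> cancel, leaving
  \<open>f x = f y + u \<bullet> (x - y)\<close>.\<close>

lemma exists_dual_point:
  assumes K: "convex K" and f: "\<And>x. GDERIV f x :> F x" and F: "continuous_on UNIV F"
    and x: "x \<in> K"
  obtains y u where "u \<in> convex hull (F ` K)"
    and "ereal (f x) = ereal (f y) - legendre_transform (log_laplace M) y
      + ereal (u \<bullet> x - log_laplace M u)"
proof -
  let ?g = "segment_gradient F x" and ?C = "convex hull (F ` K)"
  have g: "?g ` K \<subseteq> ?C"
    using segment_gradient_mem[OF F compact_K K x] by auto
  have C: "compact ?C"
    by (intro compact_convex_hull compact_continuous_image compact_K continuous_on_subset[OF F]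
        subset_UNIV)
  have cont: "continuous_on K (\<lambda>y. tilted_mean (?g y))"
    using continuous_on_compose2[OF continuous_on_tilted_mean[OF C] continuous_on_segment_gradient[OF F] g] .
  obtain y where y: "y \<in> K" "tilted_mean (?g y) = y"
    by (rule brouwer[OF compact_K K K_nonempty cont]) (auto intro: tilted_mean_mem[OF K])
  show thesis
  proof
    show "?g y \<in> ?C"
      using g y by auto
    show "ereal (f x) = ereal (f y) - legendre_transform (log_laplace M) y
      + ereal (?g y \<bullet> x - log_laplace M (?g y))"
      using legendre_transform_tilted_mean[of "?g y"] segment_gradient_mean_value[OF f F, of x y]
      by (simp add: y inner_diff_right)
  qed
qed

end

section \<open>From the pointwise bound on \<open>K\<close> to the bound on the integral\<close>

theorem theorem1p1:
  fixes \<mu> :: "(real ^ 'n) measure"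
    and f :: "real ^ 'n \<Rightarrow> real"
    and grad_f :: "real ^ 'n \<Rightarrow> real ^ 'n"
    and K N :: "(real ^ 'n) set"
    and D \<delta> :: real
  assumes "prob_space \<mu>" and "sets \<mu> = sets borel"
    and "compact (measure_support \<mu>)"
    and "\<not> (\<exists>H. is_hyperplane H \<and> measure_support \<mu> \<subseteq> H)"
    and "K = convex hull (measure_support \<mu>)"
    and "D = diameter K"
    and "\<forall>x. GDERIV f x :> grad_f x"
    and "continuous_on UNIV grad_f"
    and "\<delta> > 0"
    and "is_eps_net (\<delta> / D) (convex hull (grad_f ` K)) N"
  shows "ereal (ln (\<integral>x. exp (f x) \<partial>\<mu>))
    \<le> (SUP y. ereal (f y) - legendre_transform (log_laplace \<mu>) y)
      + ereal (ln (real (card N))) + ereal \<delta>"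
proof -
  interpret prob_space \<mu> by fact
  interpret compactly_carried_prob \<mu> K
  proof
    show "compact K"
      using assms(3,5) by (simp add: compact_convex_hull)
    show "AE x in \<mu>. x \<in> K"
      using AE_measure_support[OF assms(2)] by eventually_elim (simp add: assms(5) hull_inc)
  qed fact
  let ?S = "SUP y. ereal (f y) - legendre_transform (log_laplace \<mu>) y"
  have K: "convex K"
    by (simp add: assms(5) convex_convex_hull)
  have f: "\<And>x. GDERIV f x :> grad_f x" and F: "continuous_on UNIV grad_f"
    using assms by auto
  have contf: "continuous_on UNIV f"
    using f by (auto simp: gderiv_def intro!: has_derivative_continuous_on)
  have finN: "finite N" and net: "\<And>u. u \<in> convex hull (grad_f ` K) \<Longrightarrow> \<exists>v\<in>N. norm (u - v) \<le> \<delta> / D"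
    using assms(10) by (auto simp: is_eps_net_def)
  have N_ne: "N \<noteq> {}"
    using net K_nonempty by (metis all_not_in_conv hull_inc image_eqI)
  have D: "0 \<le> D"
    using assms(6) compact_K by (simp add: diameter_ge_0 compact_imp_bounded)
  have le_S: "\<exists>v\<in>N. ereal (f x) \<le> ?S + ereal (v \<bullet> x - log_laplace \<mu> v + \<delta>)" if x: "x \<in> K" for x
  proof -
    obtain y u where u: "u \<in> convex hull (grad_f ` K)"
      and eq: "ereal (f x) = ereal (f y) - legendre_transform (log_laplace \<mu>) y
        + ereal (u \<bullet> x - log_laplace \<mu> u)"
      by (rule exists_dual_point[OF K f F x])
    obtain v where v: "v \<in> N" "norm (u - v) \<le> \<delta> / D"
      using net[OF u] by auto
    have "norm (u - v) * D \<le> \<delta> / D * D"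
      using v(2) D by (rule mult_right_mono)
    \<comment> \<open>An inequality rather than an equality: for \<open>D = 0\<close> the left side
      is 0 by the convention for division by zero.\<close>
    also have "\<dots> \<le> \<delta>"
      using assms(9) by simp
    finally have "u \<bullet> x - log_laplace \<mu> u \<le> v \<bullet> x - log_laplace \<mu> v + \<delta>"
      using log_laplace_perturb[OF _ x] assms(6) by blast
    then have "ereal (f x) \<le> ?S + ereal (v \<bullet> x - log_laplace \<mu> v + \<delta>)"
      unfolding eq by (intro add_mono SUP_upper) auto
    with v(1) show ?thesis ..
  qed
  show ?thesis
  proof (cases ?S)
    case (real s)
    \<comment> \<open>The net point \<open>v\<close> depends on \<open>x\<close>; summing the
      positive densities over all of \<open>N\<close> removes this dependence, at the cost of the
      factor \<open>card N\<close>.\<close>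
    have "(\<integral>x. exp (f x) \<partial>\<mu>)
        \<le> (\<integral>x. exp (s + \<delta>) * (\<Sum>v\<in>N. exp (v \<bullet> x) / partition_fun v) \<partial>\<mu>)"
    proof (rule integral_mono_AE)
      show "AE x in \<mu>. exp (f x) \<le> exp (s + \<delta>) * (\<Sum>v\<in>N. exp (v \<bullet> x) / partition_fun v)"
        using AE_K
      proof eventually_elim
        fix x assume "x \<in> K"
        then obtain v where v: "v \<in> N" "f x \<le> s + \<delta> + (v \<bullet> x - log_laplace \<mu> v)"
          using le_S[of x] real by (auto simp: algebra_simps)
        have "exp (f x) \<le> exp (s + \<delta>) * (exp (v \<bullet> x) / partition_fun v)"
          using v(2) by (simp flip: exp_add exp_diff exp_log_laplace)
        also have "\<dots> \<le> exp (s + \<delta>) * (\<Sum>v\<in>N. exp (v \<bullet> x) / partition_fun v)"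
          using finN v(1) partition_fun_pos
          by (intro mult_left_mono member_le_sum) (auto simp: less_imp_le)
        finally show "exp (f x) \<le> exp (s + \<delta>) * (\<Sum>v\<in>N. exp (v \<bullet> x) / partition_fun v)" .
      qed
    qed (intro continuous_integrable continuous_intros contf partition_fun_nonzero ballI)+
    also have "\<dots> = exp (s + \<delta>) * (\<Sum>v\<in>N. \<integral>x. exp (v \<bullet> x) / partition_fun v \<partial>\<mu>)"
      using integrable_exp by simp
    also have "\<dots> = exp (s + \<delta>) * real (card N)"
      by simp
    finally have "ln (\<integral>x. exp (f x) \<partial>\<mu>) \<le> ln (exp (s + \<delta>) * real (card N))"
      using integral_exp_pos[OF contf] by (intro ln_mono) auto
    also have "\<dots> = s + ln (real (card N)) + \<delta>"
      using finN N_ne by (simp add: ln_mult card_gt_0_iff)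
    finally show ?thesis
      by (simp add: real)
  next
    case PInf
    then show ?thesis by simp
  next
    \<comment> \<open>This case is contradictory: at any point \<open>x\<close> of \<open>K\<close>,
      \<open>le_S\<close> would place the real number \<open>f x\<close> below
      \<open>-\<infinity>\<close>.\<close>
    case MInf
    then show ?thesis
      using le_S K_nonempty by fastforce
  qed
qed

end
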